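(* There is a total computable function $f:\{0,1\}^\omega\to\{0,1\}^\omega$ such that: (a) $f$ is a surjection with $f(\mathsf{ML})\cap\mathsf{ML}=\emptyset$, where $\mathsf{ML}$ is the class of Martin-Löf random reals; (b) $f$ is right-oneway but not left-oneway.
   Context: Reals are elements of $\{0,1\}^\omega$ and $\mu$ is the uniform measure. For reals $x,y$, $x\oplus y$ is the real $z$ with $z(2n)=x(n)$, $z(2n+1)=y(n)$. A partial function $f:\subseteq\{0,1\}^\omega\to\{0,1\}^\omega$ is partial computable if there is an oracle Turing functional $\Phi$ such that for every $x$: $x\in\mathrm{dom}(f)$ iff $\Phi^x(n)\downarrow$ for all $n$; and if $x\in\mathrm{dom}(f)$ then $\Phi^x(n)=f(x)(n)$ for all $n$. It is total computable if moreover $\mathrm{dom}(f)=\{0,1\}^\omega$. A partial computable $f$ is left-oneway if $\mu(\mathrm{dom}(f))>0$ and $\mu(\{x\oplus r: f(g(f(x)\oplus r))=f(x)\})=0$ for each partial computable $g:\subseteq\{0,1\}^\omega\to\{0,1\}^\omega$. It is right-oneway if $\mu(f(\{0,1\}^\omega))>0$ and $\mu(\{y\oplus r: f(g(y\oplus r))=y\})=0$ for each partial computable $g$. Here $f(\{0,1\}^\omega)$ is the range of $f$, and equations include the assertion that all terms are defined. *)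

theory Defs
  imports "HOL-Probability.Probability" "HOL-Library.Nat_Bijection"
begin

type_synonym cantor = "nat \<Rightarrow> bool"

definition join :: "cantor \<Rightarrow> cantor \<Rightarrow> cantor"  (infixl "\<oplus>" 65) where
  "x \<oplus> y = (\<lambda>n. if even n then x (n div 2) else y (n div 2))"

(* The completion is used because the range of a partial computable function is
   analytic but need not be Borel, and emeasure returns 0 outside the sigma-algebra. *)
definition cantor_measure :: "cantor measure"  ("\<mu>") where
  "\<mu> = completion (\<Pi>\<^sub>M i\<in>(UNIV :: nat set). measure_pmf (bernoulli_pmf (1/2)))"


(* Turing functionals are given by their finite programs: Kleene's schemata for the
   functions partial recursive in an oracle.  The term "run p x args" is the value of p with
   oracle x on the argument tuple args, and None stands for divergence.  Every schema is
   strict in the values it uses; arguments of the wrong number lead to divergence. *)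
datatype functional =
    Zero
  | Succ
  | Proj nat
  | Oracle
  | Comp "functional" "functional list"
  | PrimRec "functional" "functional"
  | Mu "functional"

primrec run :: "functional \<Rightarrow> cantor \<Rightarrow> nat list \<Rightarrow> nat option" where
  "run Zero x args = Some 0"
| "run Succ x args = (case args of [a] \<Rightarrow> Some (Suc a) | _ \<Rightarrow> None)"
| "run (Proj i) x args = (if i < length args then Some (args ! i) else None)"
| "run Oracle x args = (case args of [a] \<Rightarrow> Some (of_bool (x a)) | _ \<Rightarrow> None)"
| "run (Comp p qs) x args =
     (let vs = map (\<lambda>q. run q x args) qs
      in if None \<in> set vs then None else run p x (map the vs))"
| "run (PrimRec p q) x args =
     (case args of
        [] \<Rightarrow> None
      | n # as \<Rightarrow>
          rec_nat (run p x as) (\<lambda>m r. Option.bind r (\<lambda>u. run q x (u # m # as))) n)"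
| "run (Mu p) x args =
     (let stops = (\<lambda>n. run p x (n # args) = Some 0 \<and> (\<forall>m<n. run p x (m # args) \<noteq> None))
      in if \<exists>n. stops n then Some (LEAST n. stops n) else None)"


definition partial_computable :: "(cantor \<rightharpoonup> cantor) \<Rightarrow> bool" where
  "partial_computable f \<longleftrightarrow>
     (\<exists>\<Phi>. \<forall>x. (x \<in> dom f \<longleftrightarrow> (\<forall>n. run \<Phi> x [n] \<noteq> None)) \<and>
               (\<forall>y. f x = Some y \<longrightarrow> (\<forall>n. run \<Phi> x [n] = Some (of_bool (y n)))))"

definition total_computable :: "(cantor \<Rightarrow> cantor) \<Rightarrow> bool" where
  "total_computable f \<longleftrightarrow> partial_computable (\<lambda>x. Some (f x))"

definition left_oneway :: "(cantor \<rightharpoonup> cantor) \<Rightarrow> bool" where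
  "left_oneway f \<longleftrightarrow> partial_computable f \<and> emeasure \<mu> (dom f) > 0 \<and>
     (\<forall>g. partial_computable g \<longrightarrow>
        emeasure \<mu> {x \<oplus> r | x r.
          \<exists>y w. f x = Some y \<and> g (y \<oplus> r) = Some w \<and> f w = Some y} = 0)"

definition right_oneway :: "(cantor \<rightharpoonup> cantor) \<Rightarrow> bool" where
  "right_oneway f \<longleftrightarrow> partial_computable f \<and> emeasure \<mu> (ran f) > 0 \<and>
     (\<forall>g. partial_computable g \<longrightarrow>
        emeasure \<mu> {y \<oplus> r | y r. \<exists>w. g (y \<oplus> r) = Some w \<and> f w = Some y} = 0)"


definition comp_enumerable :: "nat set \<Rightarrow> bool" where
  "comp_enumerable W \<longleftrightarrow> (\<exists>p. \<forall>n. n \<in> W \<longleftrightarrow> run p (\<lambda>_. False) [n] \<noteq> None)"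

definition cylinder :: "bool list \<Rightarrow> cantor set" where
  "cylinder s = {x. \<forall>i < length s. x i = s ! i}"

definition string_code :: "bool list \<Rightarrow> nat" where
  "string_code s = list_encode (map of_bool s)"

definition martin_loef_test :: "(nat \<Rightarrow> cantor set) \<Rightarrow> bool" where
  "martin_loef_test U \<longleftrightarrow>
     (\<exists>W. comp_enumerable W \<and>
        (\<forall>n. U n = (\<Union>s \<in> {s. prod_encode (n, string_code s) \<in> W}. cylinder s))) \<and>
     (\<forall>n. emeasure \<mu> (U n) \<le> ennreal ((1/2) ^ n))"

definition MLR :: "cantor set" where
  "MLR = {x. \<forall>U. martin_loef_test U \<longrightarrow> x \<notin> (\<Inter>n. U n)}"

end

theory Submission
  imports Defs
begin

text \<open>
  The input is read as \<open>x = z \<oplus> (y \<oplus> h)\<close>.  The function outputs the bits of \<open>y\<close>, but only as long as \<open>z\<close>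
  looks like the zero sequence and \<open>h\<close> looks like a member of a certain class \<open>P\<close>; once one of the two is
  refuted, all further outputs are 0.  Here \<open>P\<close> is a nonempty class, closed and effectively so, with the
  property that no program computes a member of \<open>P\<close> from a random oracle with positive probability.

  Total computability is clear, since only finitely many decidable conditions are checked for each
  output bit.  Surjectivity holds because \<open>P\<close> is nonempty.  If \<open>x\<close> is random then \<open>z\<close> is not the zero
  sequence, so the output is eventually zero and not random.  Half of all inputs start with 1 and are
  sent to the zero sequence, whose preimage is trivial to find; so the function is not left-oneway.
  Conversely, for all \<open>y\<close> outside the null set of eventually zero sequences, a preimage of \<open>y\<close> contains a
  member of \<open>P\<close>, and none is computed from \<open>y \<oplus> r\<close> except with probability 0; so the function is
  right-oneway.

  The class \<open>P\<close> consists of all \<open>h\<close> that avoid certain forbidden values.  For each \<open>n\<close>, the index of a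
  program and a cylinder, the program is run for longer and longer on all oracles of the cylinder, until
  more than a quarter of them are seen to agree on a value 0 or 1 for \<open>h n\<close>.  The first such value is
  forbidden.  As at most one value is forbidden for each \<open>n\<close>, the class is nonempty.  If a program
  computed members of \<open>P\<close> from a set of oracles of positive measure, this set would fill more than 3/4 of
  some cylinder by \<open>ex_dense_cylinder\<close>.  For the corresponding \<open>n\<close> some value is then forbidden, and
  more than 1/4 of the cylinder is lost to it, a contradiction (\<open>avoiders_null\<close>).

  For all this, the programs have to simulate one another.  Rather than an interpreter, the proof uses
  certificates: finite sets of claims of the form "program \<open>p\<close> has value \<open>v\<close> at \<open>a\<close>" that justify one
  another.  By \<open>run_iff_accepts\<close>, a value is correct iff some certificate contains it, and whether a given
  number codes a certificate is a property with bounded quantifiers only.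
\<close>

section \<open>Writing programs in the schemata\<close>

definition env :: "nat list \<Rightarrow> nat \<Rightarrow> nat" where
  "env args i = (if i < length args then args ! i else 0)"

text \<open>
  Functions of \<open>k\<close> arguments are written as functions of an environment \<open>e\<close> that maps de Bruijn
  indices to values: \<open>e 0\<close> is the first argument.  In this form closure under each concrete
  operation is a resolution rule whose conclusion is a higher-order pattern, so that the computability
  of an explicit term is proved by repeated introduction.  Under a binder (a bounded sum or quantifier) the bound
  variable becomes \<open>e 0\<close> and the old environment is the shifted one, \<open>\<lambda>i. e (Suc i)\<close>.
\<close>

definition recursive :: "nat \<Rightarrow> (cantor \<Rightarrow> (nat \<Rightarrow> nat) \<Rightarrow> nat) \<Rightarrow> bool" where
  "recursive k F \<longleftrightarrow> (\<exists>p. \<forall>x args. length args = k \<longrightarrow> run p x args = Some (F x (env args)))"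

lemma env_Cons [simp]:
  "env (a # as) 0 = a" "env (a # as) (Suc i) = env as i"
  by (auto simp: env_def)

lemma env_Cons_tail [simp]: "(\<lambda>i. env (a # as) (Suc i)) = env as"
  by auto

lemma recursive_var: "i < k \<Longrightarrow> recursive k (\<lambda>x e. e i)"
  unfolding recursive_def by (rule exI[of _ "Proj i"]) (auto simp: env_def)

lemma recursive_const: "recursive k (\<lambda>x e. c)"
proof (induction c)
  case 0
  then show ?case unfolding recursive_def by (rule_tac exI[of _ Zero]) simp
next
  case (Suc c)
  then obtain p where "\<forall>x args. length args = k \<longrightarrow> run p x args = Some c"
    unfolding recursive_def by blast
  then show ?case unfolding recursive_def
    by (rule_tac exI[of _ "Comp Succ [p]"]) simp
qed

lemma run_Comp:
  assumes "map (\<lambda>q. run q x args) qs = map Some vs"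
  shows "run (Comp p qs) x args = run p x vs"
  by (simp add: assms o_def)

lemma recursive_compose:
  assumes G: "recursive (length Fs) G" and Fs: "\<forall>F \<in> set Fs. recursive k F"
  shows "recursive k (\<lambda>x e. G x (env (map (\<lambda>F. F x e) Fs)))"
proof -
  obtain g where g: "\<And>x args. length args = length Fs \<Longrightarrow> run g x args = Some (G x (env args))"
    using G unfolding recursive_def by blast
  from Fs obtain p where
    p: "\<And>F x args. F \<in> set Fs \<Longrightarrow> length args = k \<Longrightarrow> run (p F) x args = Some (F x (env args))"
    unfolding recursive_def by metis
  have "run (Comp g (map p Fs)) x args = Some (G x (env (map (\<lambda>F. F x (env args)) Fs)))"
    if "length args = k" for x args
  proof -
    have "map (\<lambda>q. run q x args) (map p Fs) = map Some (map (\<lambda>F. F x (env args)) Fs)"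
      using p that by simp
    from run_Comp[OF this] show ?thesis
      using g by simp
  qed
  then show ?thesis unfolding recursive_def by blast
qed

lemma recursive_compose1:
  assumes "recursive 1 (\<lambda>x e. F x (e 0))" "recursive k A"
  shows "recursive k (\<lambda>x e. F x (A x e))"
  using recursive_compose[of "[A]" "\<lambda>x e. F x (e 0)" k] assms by simp

lemma recursive_compose2:
  assumes "recursive 2 (\<lambda>x e. F x (e 0) (e 1))" "recursive k A" "recursive k B"
  shows "recursive k (\<lambda>x e. F x (A x e) (B x e))"
  using recursive_compose[of "[A, B]" "\<lambda>x e. F x (e 0) (e 1)" k] assms
  by (simp add: numeral_2_eq_2)

lemma recursive_compose3:
  assumes "recursive 3 (\<lambda>x e. F x (e 0) (e 1) (e 2))"
    "recursive k A" "recursive k B" "recursive k C"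
  shows "recursive k (\<lambda>x e. F x (A x e) (B x e) (C x e))"
  using recursive_compose[of "[A, B, C]" "\<lambda>x e. F x (e 0) (e 1) (e 2)" k] assms
  by (simp add: numeral_2_eq_2 numeral_3_eq_3)

lemma recursive_weaken:
  assumes "recursive k F"
  shows "recursive (Suc k) (\<lambda>x e. F x (\<lambda>i. e (Suc i)))"
proof -
  obtain p where p: "\<And>x args. length args = k \<Longrightarrow> run p x args = Some (F x (env args))"
    using assms unfolding recursive_def by blast
  have "run (Comp p (map (\<lambda>i. Proj (Suc i)) [0..<k])) x args = Some (F x (\<lambda>i. env args (Suc i)))"
    if len: "length args = Suc k" for x args
  proof -
    obtain a as where args: "args = a # as" "length as = k"
      using len by (cases args) auto
    have "map (\<lambda>q. run q x args) (map (\<lambda>i. Proj (Suc i)) [0..<k]) = map Some as"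
      using args by (auto simp: list_eq_iff_nth_eq)
    from run_Comp[OF this] show ?thesis
      using p[OF args(2)] by (simp add: args)
  qed
  then show ?thesis unfolding recursive_def by blast
qed

text \<open>
  In the step program, the schema puts the previous value first and the counter second, whence
  the order \<open>e 1\<close>, \<open>e 0\<close>.
\<close>

lemma recursive_rec:
  assumes N: "recursive k N" and A: "recursive k A"
    and G: "recursive (Suc (Suc k)) (\<lambda>x e. G x (e 1) (e 0) (\<lambda>i. e (Suc (Suc i))))"
  shows "recursive k (\<lambda>x e. rec_nat (A x e) (\<lambda>m r. G x m r e) (N x e))"
proof -
  obtain n a g where n: "\<And>x args. length args = k \<Longrightarrow> run n x args = Some (N x (env args))"
    and a: "\<And>x args. length args = k \<Longrightarrow> run a x args = Some (A x (env args))"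
    and g: "\<And>x args. length args = Suc (Suc k) \<Longrightarrow>
      run g x args = Some (G x (env args 1) (env args 0) (\<lambda>i. env args (Suc (Suc i))))"
    using assms unfolding recursive_def by metis
  have rec: "run (PrimRec a g) x (m # args) = Some (rec_nat (A x (env args)) (\<lambda>m r. G x m r (env args)) m)"
    if len: "length args = k" for x args m
    by (induction m) (auto simp: a[OF len] g len)
  have "run (Comp (PrimRec a g) (n # map Proj [0..<k])) x args
      = Some (rec_nat (A x (env args)) (\<lambda>m r. G x m r (env args)) (N x (env args)))"
    if len: "length args = k" for x args
  proof -
    have "map (\<lambda>q. run q x args) (n # map Proj [0..<k]) = map Some (N x (env args) # args)"
      using n[OF len] len by (auto intro!: nth_equalityI)
    from run_Comp[OF this] show ?thesis
      using rec[OF len] by simp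
  qed
  then show ?thesis unfolding recursive_def by blast
qed

lemma recursive_Suc_var: "recursive 1 (\<lambda>x e. Suc (e 0))"
  unfolding recursive_def
  by (rule exI[of _ Succ]) (auto simp: length_Suc_conv)

lemma recursive_oracle_var: "recursive 1 (\<lambda>x e. of_bool (x (e 0)))"
  unfolding recursive_def
  by (rule exI[of _ Oracle]) (auto simp: length_Suc_conv)

lemmas recursive_Suc = recursive_compose1[OF recursive_Suc_var]
lemmas recursive_oracle = recursive_compose1[OF recursive_oracle_var]

lemmas recursive_base =
  recursive_var recursive_const recursive_rec recursive_Suc recursive_oracle

lemma recursive_pred: "recursive k A \<Longrightarrow> recursive k (\<lambda>x e. A x e - 1)"
proof (rule recursive_compose1[where F = "\<lambda>x a. a - 1"])
  have *: "rec_nat 0 (\<lambda>m r. m) a = a - 1" for a :: nat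
    by (cases a) auto
  have "recursive 1 (\<lambda>x e. rec_nat 0 (\<lambda>m r. m) (e 0))"
    by (intro recursive_base; simp)
  then show "recursive 1 (\<lambda>x e. e 0 - 1)"
    by (simp only: *)
qed

lemma recursive_add:
  "recursive k A \<Longrightarrow> recursive k B \<Longrightarrow> recursive k (\<lambda>x e. A x e + B x e)"
proof (rule recursive_compose2[where F = "\<lambda>x a b. a + b"])
  have "a + b = rec_nat b (\<lambda>_. Suc) a" for a b :: nat
    by (induction a) auto
  then show "recursive 2 (\<lambda>x e. e 0 + e 1)"
    by simp (intro recursive_base; simp)
qed

lemma recursive_diff:
  "recursive k A \<Longrightarrow> recursive k B \<Longrightarrow> recursive k (\<lambda>x e. A x e - B x e)"
proof (rule recursive_compose2[where F = "\<lambda>x a b. a - b"])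
  have *: "rec_nat a (\<lambda>_ r. r - 1) b = a - b" for a b :: nat
    by (induction b) auto
  have "recursive 2 (\<lambda>x e. rec_nat (e 0) (\<lambda>_ r. r - 1) (e 1))"
    by (intro recursive_base recursive_pred; simp)
  then show "recursive 2 (\<lambda>x e. e 0 - e 1)"
    by (simp only: *)
qed

lemma recursive_sum:
  assumes "recursive k B" "recursive (Suc k) (\<lambda>x e. F x (e 0) (\<lambda>i. e (Suc i)))"
  shows "recursive k (\<lambda>x e. \<Sum>i<B x e. F x i e)"
proof -
  have "(\<Sum>i<b. F x i e) = rec_nat 0 (\<lambda>m r. r + F x m e) b" for x e b
    by (induction b) auto
  then show ?thesis
    using recursive_weaken[OF assms(2)]
    by simp (intro recursive_base recursive_add assms; simp)
qed

lemma recursive_mult: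
  "recursive k A \<Longrightarrow> recursive k B \<Longrightarrow> recursive k (\<lambda>x e. A x e * B x e)"
proof (rule recursive_compose2[where F = "\<lambda>x a b. a * b"])
  have "a * b = (\<Sum>i<a. b)" for a b :: nat by simp
  then show "recursive 2 (\<lambda>x e. e 0 * e 1)"
    by (simp only:) (intro recursive_base recursive_sum; simp)
qed

lemma recursive_power2: "recursive k A \<Longrightarrow> recursive k (\<lambda>x e. 2 ^ A x e)"
proof (rule recursive_compose1[where F = "\<lambda>x a. 2 ^ a"])
  have "2 ^ a = rec_nat (1::nat) (\<lambda>_ r. r + r) a" for a
    by (induction a) auto
  then show "recursive 1 (\<lambda>x e. 2 ^ e 0)"
    by simp (intro recursive_base recursive_add; simp)
qed

lemma recursive_not:
  assumes "recursive k (\<lambda>x e. of_bool (P x e))"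
  shows "recursive k (\<lambda>x e. of_bool (\<not> P x e))"
proof -
  have "of_bool (\<not> P x e) = (1::nat) - of_bool (P x e)" for x e by simp
  then show ?thesis
    by (simp only:) (intro recursive_const recursive_diff assms)
qed

lemma recursive_conj:
  assumes "recursive k (\<lambda>x e. of_bool (P x e))" "recursive k (\<lambda>x e. of_bool (Q x e))"
  shows "recursive k (\<lambda>x e. of_bool (P x e \<and> Q x e))"
  by (simp only: of_bool_conj) (intro recursive_mult assms)

lemma recursive_disj:
  assumes "recursive k (\<lambda>x e. of_bool (P x e))" "recursive k (\<lambda>x e. of_bool (Q x e))"
  shows "recursive k (\<lambda>x e. of_bool (P x e \<or> Q x e))"
proof -
  have "(P x e \<or> Q x e) = (\<not> (\<not> P x e \<and> \<not> Q x e))" for x e by blast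
  then show ?thesis
    by (simp only:) (intro recursive_not recursive_conj assms)
qed

lemma recursive_imp:
  assumes "recursive k (\<lambda>x e. of_bool (P x e))" "recursive k (\<lambda>x e. of_bool (Q x e))"
  shows "recursive k (\<lambda>x e. of_bool (P x e \<longrightarrow> Q x e))"
  by (simp only: imp_conv_disj) (intro recursive_disj recursive_not assms)

lemma recursive_le:
  assumes "recursive k A" "recursive k B"
  shows "recursive k (\<lambda>x e. of_bool (A x e \<le> B x e))"
proof -
  have "of_bool (A x e \<le> B x e) = 1 - (A x e - B x e)" for x e by auto
  then show ?thesis
    by (simp only:) (intro recursive_diff recursive_const assms)
qed

lemma recursive_less:
  assumes "recursive k A" "recursive k B"
  shows "recursive k (\<lambda>x e. of_bool (A x e < B x e))"
  unfolding less_eq_Suc_le by (intro recursive_le recursive_Suc assms)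

lemma recursive_eq:
  assumes "recursive k A" "recursive k B"
  shows "recursive k (\<lambda>x e. of_bool (A x e = B x e))"
  unfolding eq_iff by (intro recursive_le recursive_conj assms)

lemma recursive_iff:
  assumes "recursive k (\<lambda>x e. of_bool (P x e))" "recursive k (\<lambda>x e. of_bool (Q x e))"
  shows "recursive k (\<lambda>x e. of_bool (P x e \<longleftrightarrow> Q x e))"
  by (simp only: iff_conv_conj_imp) (intro recursive_conj recursive_imp assms)

lemma recursive_ex:
  assumes "recursive k B" "recursive (Suc k) (\<lambda>x e. of_bool (P x (e 0) (\<lambda>i. e (Suc i))))"
  shows "recursive k (\<lambda>x e. of_bool (\<exists>i<B x e. P x i e))"
proof -
  have "(\<exists>i<B x e. P x i e) \<longleftrightarrow> 0 < (\<Sum>i<B x e. of_bool (P x i e) :: nat)" for x e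
    by (auto simp: card_gt_0_iff)
  then show ?thesis
    by (simp only:) (intro recursive_less recursive_const recursive_sum assms)
qed

lemma recursive_all:
  assumes "recursive k B" "recursive (Suc k) (\<lambda>x e. of_bool (P x (e 0) (\<lambda>i. e (Suc i))))"
  shows "recursive k (\<lambda>x e. of_bool (\<forall>i<B x e. P x i e))"
proof -
  have "(\<forall>i<B x e. P x i e) \<longleftrightarrow> \<not> (\<exists>i<B x e. \<not> P x i e)" for x e
    by blast
  then show ?thesis
    by (simp only:) (intro recursive_not recursive_ex assms)
qed

lemmas recursive_arith =
  recursive_var recursive_const recursive_Suc recursive_oracle
  recursive_add recursive_diff recursive_sum recursive_mult recursive_power2
  recursive_not recursive_conj recursive_disj recursive_imp recursive_le recursive_less
  recursive_eq recursive_iff recursive_ex recursive_all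

section \<open>Pairs, finite sets and lists of numbers\<close>

definition pfst :: "nat \<Rightarrow> nat" where "pfst n = fst (prod_decode n)"
definition psnd :: "nat \<Rightarrow> nat" where "psnd n = snd (prod_decode n)"

lemma pfst_encode [simp]: "pfst (prod_encode (a, b)) = a"
  and psnd_encode [simp]: "psnd (prod_encode (a, b)) = b"
  by (simp_all add: pfst_def psnd_def)

lemma pair_collapse [simp]: "prod_encode (pfst n, psnd n) = n"
  by (simp add: pfst_def psnd_def)

lemma recursive_prod_encode:
  "recursive k A \<Longrightarrow> recursive k B \<Longrightarrow> recursive k (\<lambda>x e. prod_encode (A x e, B x e))"
proof (rule recursive_compose2[where F = "\<lambda>x a b. prod_encode (a, b)"])
  have "triangle a = (\<Sum>i<Suc a. i)" for a by (induction a) auto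
  then show "recursive 2 (\<lambda>x e. prod_encode (e 0, e 1))"
    unfolding prod_encode_def by simp (intro recursive_arith; simp)
qed

lemma prod_encode_eq_iff: "prod_encode (a, b) = n \<longleftrightarrow> a = pfst n \<and> b = psnd n"
  by (metis pair_collapse pfst_encode psnd_encode)

lemma pfst_le: "pfst n \<le> n" and psnd_le: "psnd n \<le> n"
  by (metis pair_collapse le_prod_encode_1, metis pair_collapse le_prod_encode_2)

text \<open>
  The unpairing functions are recovered from pairing without a search: a sum over all candidates
  in which only the right one contributes.
\<close>

lemma sum_select: "a < n \<Longrightarrow> (\<Sum>i<n. g i * of_bool (i = a \<and> Q i)) = g a * of_bool (Q a)"
  for g :: "nat \<Rightarrow> nat"
  by (subst sum.remove[of _ a]) (auto intro!: sum.neutral)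

lemma recursive_pfst: "recursive k A \<Longrightarrow> recursive k (\<lambda>x e. pfst (A x e))"
proof (rule recursive_compose1[where F = "\<lambda>x. pfst"])
  have *: "pfst n = (\<Sum>a<Suc n. a * of_bool (\<exists>b<Suc n. prod_encode (a, b) = n))" for n
    using sum_select[of "pfst n" "Suc n" "\<lambda>a. a" "\<lambda>_. True"] pfst_le[of n] psnd_le[of n]
    by (simp add: prod_encode_eq_iff less_Suc_eq_le conj_commute cong: conj_cong)
  show "recursive 1 (\<lambda>x e. pfst (e 0))"
    unfolding * by (intro recursive_arith recursive_prod_encode; simp)
qed

lemma recursive_psnd: "recursive k A \<Longrightarrow> recursive k (\<lambda>x e. psnd (A x e))"
proof (rule recursive_compose1[where F = "\<lambda>x. psnd"])
  have *: "psnd n = (\<Sum>b<Suc n. b * of_bool (\<exists>a<Suc n. prod_encode (a, b) = n))" for n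
    using sum_select[of "psnd n" "Suc n" "\<lambda>a. a" "\<lambda>_. True"] pfst_le[of n] psnd_le[of n]
    by (simp add: prod_encode_eq_iff less_Suc_eq_le conj_commute cong: conj_cong)
  show "recursive 1 (\<lambda>x e. psnd (e 0))"
    unfolding * by (intro recursive_arith recursive_prod_encode; simp)
qed

lemma recursive_in_set_decode:
  "recursive k A \<Longrightarrow> recursive k B \<Longrightarrow> recursive k (\<lambda>x e. of_bool (A x e \<in> set_decode (B x e)))"
proof (rule recursive_compose2[where F = "\<lambda>x a b. of_bool (a \<in> set_decode b)"])
  \<comment> \<open>Division and parity become bounded quantifiers: bit \<open>a\<close> of \<open>b\<close> is 1 iff the quotient is odd.\<close>
  have *: "a \<in> set_decode b \<longleftrightarrow> (\<exists>q<Suc b. \<exists>r<2 ^ a. b = (2 * q + 1) * 2 ^ a + r)" (is "_ \<longleftrightarrow> ?R") for a b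
  proof
    assume "a \<in> set_decode b"
    then have odd: "odd (b div 2 ^ a)" by (simp add: set_decode_def)
    then obtain q where q: "b div 2 ^ a = 2 * q + 1" by (blast elim: oddE)
    then have "b = (2 * q + 1) * 2 ^ a + b mod 2 ^ a"
      by (metis div_mult_mod_eq)
    moreover have "q \<le> b div 2 ^ a" using q by linarith
    moreover have "b div 2 ^ a \<le> b" by simp
    moreover have "b mod 2 ^ a < 2 ^ a" by simp
    ultimately show ?R by (metis le_imp_less_Suc le_trans)
  next
    assume ?R
    then obtain q r where "r < 2 ^ a" "b = (2 * q + 1) * 2 ^ a + r" by blast
    then have "b div 2 ^ a = 2 * q + 1" by (simp only:) (subst div_mult_self3; simp)
    then show "a \<in> set_decode b" by (simp add: set_decode_def)
  qed
  show "recursive 2 (\<lambda>x e. of_bool (e 0 \<in> set_decode (e 1)))"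
    unfolding * by (intro recursive_arith; simp)
qed

text \<open>
  Since \<open>list_encode\<close> codes the empty list by 0 and a nonempty one by the successor of a pair, the
  predecessor is unpaired; the tail of 0 comes out as 0, so that dropping too many entries gives 0.
\<close>

definition lhd :: "nat \<Rightarrow> nat" where "lhd l = pfst (l - 1)"
definition ltl :: "nat \<Rightarrow> nat" where "ltl l = psnd (l - 1)"
definition lcons :: "nat \<Rightarrow> nat \<Rightarrow> nat" where "lcons a l = Suc (prod_encode (a, l))"
definition ldrop :: "nat \<Rightarrow> nat \<Rightarrow> nat" where "ldrop l i = rec_nat l (\<lambda>_. ltl) i"
definition lnth :: "nat \<Rightarrow> nat \<Rightarrow> nat" where "lnth l i = lhd (ldrop l i)"
definition llen :: "nat \<Rightarrow> nat" where "llen l = (\<Sum>i<l. of_bool (ldrop l i \<noteq> 0))"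

lemma lcons_encode: "lcons a (list_encode as) = list_encode (a # as)"
  by (simp add: lcons_def)

lemma ltl_encode [simp]: "ltl (list_encode xs) = list_encode (tl xs)"
  by (cases xs) (use psnd_le[of 0] in \<open>simp_all add: ltl_def\<close>)

lemma lhd_encode [simp]: "xs \<noteq> [] \<Longrightarrow> lhd (list_encode xs) = hd xs"
  by (cases xs) (simp_all add: lhd_def)

lemma ldrop_encode [simp]: "ldrop (list_encode xs) i = list_encode (drop i xs)"
  by (induction i) (simp_all add: ldrop_def drop_Suc tl_drop)

lemma lnth_encode [simp]: "i < length xs \<Longrightarrow> lnth (list_encode xs) i = xs ! i"
  by (simp add: lnth_def hd_drop_conv_nth)

lemma length_le_list_encode: "length xs \<le> list_encode xs"
proof (induction xs)
  case (Cons a xs)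
  then show ?case using le_prod_encode_2[of "list_encode xs" a] by simp
qed simp

lemma list_encode_eq_0 [simp]: "list_encode xs = 0 \<longleftrightarrow> xs = []"
  by (cases xs) auto

lemma llen_encode [simp]: "llen (list_encode xs) = length xs"
proof -
  have "llen (list_encode xs) = card {i. i < list_encode xs \<and> i < length xs}"
    by (auto simp: llen_def Collect_conj_eq lessThan_def not_le)
  also have "{i. i < list_encode xs \<and> i < length xs} = {..<length xs}"
    using length_le_list_encode[of xs] by auto
  finally show ?thesis by simp
qed

lemma recursive_ltl: "recursive k A \<Longrightarrow> recursive k (\<lambda>x e. ltl (A x e))"
  unfolding ltl_def by (intro recursive_arith recursive_psnd)

lemma recursive_lhd: "recursive k A \<Longrightarrow> recursive k (\<lambda>x e. lhd (A x e))"
  unfolding lhd_def by (intro recursive_arith recursive_pfst)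

lemma recursive_lcons:
  "recursive k A \<Longrightarrow> recursive k B \<Longrightarrow> recursive k (\<lambda>x e. lcons (A x e) (B x e))"
  unfolding lcons_def by (intro recursive_arith recursive_prod_encode)

lemma recursive_ldrop:
  "recursive k A \<Longrightarrow> recursive k B \<Longrightarrow> recursive k (\<lambda>x e. ldrop (A x e) (B x e))"
proof (rule recursive_compose2[where F = "\<lambda>x. ldrop"])
  show "recursive 2 (\<lambda>x e. ldrop (e 0) (e 1))"
    unfolding ldrop_def by (intro recursive_var recursive_rec recursive_ltl; simp)
qed

lemma recursive_lnth:
  "recursive k A \<Longrightarrow> recursive k B \<Longrightarrow> recursive k (\<lambda>x e. lnth (A x e) (B x e))"
  unfolding lnth_def by (intro recursive_lhd recursive_ldrop)

lemma recursive_llen: "recursive k A \<Longrightarrow> recursive k (\<lambda>x e. llen (A x e))"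
proof (rule recursive_compose1[where F = "\<lambda>x. llen"])
  show "recursive 1 (\<lambda>x e. llen (e 0))"
    unfolding llen_def by (intro recursive_arith recursive_ldrop; simp)
qed

lemmas recursive_intros = recursive_arith recursive_prod_encode recursive_pfst recursive_psnd
  recursive_in_set_decode recursive_ltl recursive_lhd recursive_lcons recursive_lnth recursive_llen

section \<open>Certificates for computations\<close>

primrec code :: "functional \<Rightarrow> nat" where
  "code Zero = prod_encode (0, 0)"
| "code Succ = prod_encode (1, 0)"
| "code (Proj i) = prod_encode (2, i)"
| "code Oracle = prod_encode (3, 0)"
| "code (Comp p qs) = prod_encode (4, prod_encode (code p, list_encode (map code qs)))"
| "code (PrimRec p q) = prod_encode (5, prod_encode (code p, code q))"
| "code (Mu p) = prod_encode (6, code p)"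

definition triple :: "nat \<Rightarrow> nat \<Rightarrow> nat \<Rightarrow> nat" where
  "triple p a v = prod_encode (p, prod_encode (a, v))"

lemma triple_eq_iff [simp]: "triple p a v = triple p' a' v' \<longleftrightarrow> p = p' \<and> a = a' \<and> v = v'"
  by (auto simp: triple_def)

text \<open>
  A triple \<open>(p, a, v)\<close> claims that the program with code \<open>p\<close> has value \<open>v\<close> on the argument tuple
  with code \<open>a\<close>.  It is justified by a set \<open>S\<close> of claims if one application of the evaluation rules
  derives it from claims in \<open>S\<close>; the seven disjuncts are the seven schemata.  Oracle questions are
  limited to positions below \<open>s\<close>, which makes the notion depend on a finite part of the oracle only.
\<close>

definition justified :: "cantor \<Rightarrow> nat \<Rightarrow> nat set \<Rightarrow> nat \<Rightarrow> nat \<Rightarrow> nat \<Rightarrow> bool" where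
  "justified x s S p a v \<longleftrightarrow>
     (pfst p = 0 \<and> v = 0) \<or>
     (pfst p = 1 \<and> 0 < v \<and> a = lcons (v - 1) 0) \<or>
     (pfst p = 2 \<and> psnd p < llen a \<and> v = lnth a (psnd p)) \<or>
     (pfst p = 3 \<and> (\<exists>b<s. a = lcons b 0 \<and> v = of_bool (x b))) \<or>
     (pfst p = 4 \<and> (\<exists>w. llen w = llen (psnd (psnd p)) \<and> triple (pfst (psnd p)) w v \<in> S \<and>
        (\<forall>j<llen w. triple (lnth (psnd (psnd p)) j) a (lnth w j) \<in> S))) \<or>
     (pfst p = 5 \<and> a \<noteq> 0 \<and>
        (lhd a = 0 \<and> triple (pfst (psnd p)) (ltl a) v \<in> S \<or>
         0 < lhd a \<and> (\<exists>u. triple p (lcons (lhd a - 1) (ltl a)) u \<in> S \<and>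
           triple (psnd (psnd p)) (lcons u (lcons (lhd a - 1) (ltl a))) v \<in> S))) \<or>
     (pfst p = 6 \<and> triple (psnd p) (lcons v a) 0 \<in> S \<and>
        (\<forall>m<v. \<exists>u. triple (psnd p) (lcons m a) (Suc u) \<in> S))"

text \<open>
  A certificate for a computation is a set of claims that justify each other.  Circular
  justification cannot occur: a claim can only rest on claims about proper subprograms or, for
  primitive recursion, about the same program with a smaller counter.  Hence no order on the claims
  has to be recorded, and certificates can be united freely.
\<close>

definition certificate :: "cantor \<Rightarrow> nat \<Rightarrow> nat set \<Rightarrow> bool" where
  "certificate x s S \<longleftrightarrow> (\<forall>p a v. triple p a v \<in> S \<longrightarrow> justified x s S p a v)"

lemma justified_mono:
  assumes "justified x s S p a v" "s \<le> s'" "S \<subseteq> S'"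
  shows "justified x s' S' p a v"
proof -
  have s: "\<And>b. b < s \<Longrightarrow> b < s'" and S: "\<And>t. t \<in> S \<Longrightarrow> t \<in> S'"
    using assms(2,3) by auto
  show ?thesis
    using assms(1) unfolding justified_def
    by (elim disj_forward conj_forward ex_forward all_forward imp_forward)
      (assumption | erule s | erule S)+
qed

lemma justified_cong:
  assumes "\<And>b. b < s \<Longrightarrow> x b = y b"
  shows "justified x s S p a v = justified y s S p a v"
  unfolding justified_def by (simp add: assms cong: conj_cong)

lemma certificate_cong:
  assumes "\<And>b. b < s \<Longrightarrow> x b = y b"
  shows "certificate x s S = certificate y s S"
  unfolding certificate_def using justified_cong[of s x y, OF assms] by blast

lemma certificate_mono: "certificate x s S \<Longrightarrow> s \<le> s' \<Longrightarrow> certificate x s' S"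
  unfolding certificate_def using justified_mono by blast

lemma certificate_union:
  "certificate x s S \<Longrightarrow> certificate x s' S' \<Longrightarrow> certificate x (max s s') (S \<union> S')"
  unfolding certificate_def
  by (metis Un_iff Un_upper1 Un_upper2 justified_mono max.cobounded1 max.cobounded2)

text \<open>
  The induction on \<open>p\<close>, with an inner one on the counter, is what rules out circularity.
\<close>

lemma certificate_sound:
  assumes cert: "certificate x s S"
  shows "triple (code p) (list_encode args) v \<in> S \<Longrightarrow> run p x args = Some v"
proof (induction p arbitrary: args v)
  case (Comp p qs)
  from cert Comp.prems have "justified x s S (code (Comp p qs)) (list_encode args) v"
    unfolding certificate_def by blast
  then obtain w where w: "llen w = length qs" "triple (code p) w v \<in> S"
    and q: "\<forall>j<length qs. triple (lnth (list_encode (map code qs)) j) (list_encode args) (lnth w j) \<in> S"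
    unfolding justified_def by auto
  define ws where "ws = list_decode w"
  have ws: "w = list_encode ws" "length ws = length qs"
    using w(1) llen_encode[of ws] by (simp_all add: ws_def)
  have "map (\<lambda>q. run q x args) qs = map Some ws"
  proof (rule nth_equalityI)
    fix j assume "j < length (map (\<lambda>q. run q x args) qs)"
    then have j: "j < length qs" by simp
    with q have "triple (code (qs ! j)) (list_encode args) (ws ! j) \<in> S"
      using ws by auto
    with Comp.IH(2)[of "qs ! j" args "ws ! j"] j ws
    show "map (\<lambda>q. run q x args) qs ! j = map Some ws ! j" by simp
  qed (use ws in simp)
  from run_Comp[OF this, of p] Comp.IH(1)[of ws v] w(2) ws(1) show ?case by simp
next
  case (PrimRec p q)
  let ?P = "PrimRec p q"
  have "\<And>v. triple (code ?P) (list_encode (n # as)) v \<in> S \<Longrightarrow> run ?P x (n # as) = Some v" for n as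
  proof (induction n)
    case 0
    then have "justified x s S (code ?P) (list_encode (0 # as)) v"
      using cert unfolding certificate_def by blast
    then have "triple (code p) (list_encode as) v \<in> S"
      unfolding justified_def by (simp del: list_encode.simps)
    then show ?case using PrimRec.IH(1) by simp
  next
    case (Suc n)
    then have "justified x s S (code ?P) (list_encode (Suc n # as)) v"
      using cert unfolding certificate_def by blast
    then obtain u where "triple (code ?P) (list_encode (n # as)) u \<in> S"
      "triple (code q) (list_encode (u # n # as)) v \<in> S"
      unfolding justified_def by (auto simp: lcons_encode simp del: list_encode.simps)
    with Suc.IH[of u] PrimRec.IH(2)[of "u # n # as" v] show ?case by simp
  qed
  moreover have "justified x s S (code ?P) (list_encode args) v"
    using cert PrimRec.prems unfolding certificate_def by blast
  then have "args \<noteq> []" unfolding justified_def by auto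
  ultimately show ?case using PrimRec.prems by (cases args) auto
next
  case (Mu p)
  from cert Mu.prems have "justified x s S (code (Mu p)) (list_encode args) v"
    unfolding certificate_def by blast
  then have v: "run p x (v # args) = Some 0" and "\<forall>m<v. \<exists>u. run p x (m # args) = Some (Suc u)"
    unfolding justified_def using Mu.IH by (auto simp: lcons_encode simp del: list_encode.simps)
  then have m: "\<forall>m<v. run p x (m # args) \<noteq> None \<and> run p x (m # args) \<noteq> Some 0" by fastforce
  let ?stops = "\<lambda>n. run p x (n # args) = Some 0 \<and> (\<forall>m<n. run p x (m # args) \<noteq> None)"
  have "(LEAST n. ?stops n) = v"
    using v m by (intro Least_equality) (auto simp: not_less[symmetric])
  moreover have "\<exists>n. ?stops n" using v m by blast
  ultimately show ?case by (simp add: Let_def)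
qed (use cert in \<open>auto simp: certificate_def justified_def lcons_def dest!: spec split: list.splits\<close>)

text \<open>
  Certification with the bounds hidden, as needed for the induction that proves completeness.
\<close>

definition derivable :: "cantor \<Rightarrow> nat \<Rightarrow> nat \<Rightarrow> nat \<Rightarrow> bool" where
  "derivable x p a v \<longleftrightarrow> (\<exists>s S. finite S \<and> certificate x s S \<and> triple p a v \<in> S)"

text \<open>
  Finitely many certificates are united, and the claim that they justify is added.
\<close>

lemma derivable_step:
  assumes "finite T" "\<And>p a v. triple p a v \<in> T \<Longrightarrow> derivable x p a v" "justified x s T p a v"
    "\<And>t. t \<in> T \<Longrightarrow> \<exists>p a v. t = triple p a v"
  shows "derivable x p a v"
proof -
  have "\<exists>s' S. finite S \<and> certificate x s' S \<and> T' \<subseteq> S" if "T' \<subseteq> T" for T'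
    using finite_subset[OF that assms(1)] that
  proof (induction T' rule: finite_induct)
    case empty
    then show ?case by (intro exI[of _ "{}"] exI) (auto simp: certificate_def)
  next
    case (insert t T')
    then obtain s1 S1 where "finite S1" "certificate x s1 S1" "T' \<subseteq> S1" by blast
    moreover obtain s2 S2 where "finite S2" "certificate x s2 S2" "t \<in> S2"
      using insert.prems assms(2,4) unfolding derivable_def by (metis insert_subset)
    ultimately show ?case
      by (intro exI[of _ "max s1 s2"] exI[of _ "S1 \<union> S2"]) (auto intro: certificate_union)
  qed
  from this[of T] obtain s' S where S: "finite S" "certificate x s' S" "T \<subseteq> S" by blast
  have "certificate x (max s s') (insert (triple p a v) S)"
    unfolding certificate_def
  proof (intro allI impI)
    fix p' a' v' assume "triple p' a' v' \<in> insert (triple p a v) S"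
    then consider "p' = p" "a' = a" "v' = v" | "triple p' a' v' \<in> S" by auto
    then show "justified x (max s s') (insert (triple p a v) S) p' a' v'"
    proof cases
      case 1
      then show ?thesis using justified_mono[OF assms(3)] S(3) by (meson max.cobounded1 subset_insertI2)
    next
      case 2
      then show ?thesis using S(2) justified_mono unfolding certificate_def
        by (meson max.cobounded2 subset_insertI)
    qed
  qed
  then show ?thesis using S(1) unfolding derivable_def by blast
qed

lemma derivable_run: "run p x args = Some v \<Longrightarrow> derivable x (code p) (list_encode args) v"
proof (induction p arbitrary: args v)
  case Zero
  then show ?case by (auto intro!: derivable_step[of "{}" _ 0] simp: justified_def)
next
  case Succ
  then show ?case
    by (auto intro!: derivable_step[of "{}" _ 0] simp: justified_def lcons_def split: list.splits)
next
  case (Proj i)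
  then show ?case
    by (auto intro!: derivable_step[of "{}" _ 0] simp: justified_def split: if_splits)
next
  case Oracle
  then obtain b where b: "args = [b]" "v = of_bool (x b)" by (auto split: list.splits)
  then show ?case
    by (auto intro!: derivable_step[of "{}" _ "Suc b"] simp: justified_def lcons_def)
next
  case (Comp p qs)
  let ?vs = "map (\<lambda>q. run q x args) qs"
  define ws where "ws = map the ?vs"
  have none: "None \<notin> set ?vs" and p: "run p x ws = Some v"
    using Comp.prems by (auto simp: Let_def ws_def split: if_splits)
  have len: "length ws = length qs" by (simp add: ws_def)
  have q: "run (qs ! j) x args = Some (ws ! j)" if "j < length qs" for j
  proof -
    have "run (qs ! j) x args \<in> set ?vs" using that by simp
    with none have "run (qs ! j) x args \<noteq> None" by metis
    then show ?thesis using that by (auto simp: ws_def)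
  qed
  let ?T = "insert (triple (code p) (list_encode ws) v)
    ((\<lambda>j. triple (code (qs ! j)) (list_encode args) (ws ! j)) ` {..<length qs})"
  show ?case
  proof (rule derivable_step[of ?T _ 0])
    show "derivable x p' a' v'" if "triple p' a' v' \<in> ?T" for p' a' v'
      using that Comp.IH(1)[OF p] Comp.IH(2)[OF nth_mem q] by auto
    show "justified x 0 ?T (code (Comp p qs)) (list_encode args) v"
      unfolding justified_def by (auto simp: len intro!: exI[of _ "list_encode ws"])
  qed auto
next
  case (PrimRec p q)
  let ?P = "PrimRec p q"
  have "\<And>v. run ?P x (n # as) = Some v \<Longrightarrow> derivable x (code ?P) (list_encode (n # as)) v" for n as
  proof (induction n)
    case 0
    then have p: "derivable x (code p) (list_encode as) v"
      using PrimRec.IH(1) by simp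
    show ?case
    proof (rule derivable_step[of "{triple (code p) (list_encode as) v}" _ 0])
      show "derivable x p' a' v'" if "triple p' a' v' \<in> {triple (code p) (list_encode as) v}" for p' a' v'
        using that p by simp
    qed (auto simp: justified_def simp del: list_encode.simps)
  next
    case (Suc n)
    then obtain u where u: "run ?P x (n # as) = Some u" "run q x (u # n # as) = Some v"
      by (auto simp: bind_eq_Some_conv)
    show ?case
    proof (rule derivable_step[of "{triple (code ?P) (list_encode (n # as)) u,
          triple (code q) (list_encode (u # n # as)) v}" _ 0])
      show "derivable x p' a' v'" if "triple p' a' v' \<in> {triple (code ?P) (list_encode (n # as)) u,
          triple (code q) (list_encode (u # n # as)) v}" for p' a' v'
        using that Suc.IH[OF u(1)] PrimRec.IH(2)[OF u(2)] by auto
    qed (auto simp: justified_def lcons_encode simp del: list_encode.simps)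
  qed
  then show ?case using PrimRec.prems by (cases args) auto
next
  case (Mu p)
  let ?stops = "\<lambda>n. run p x (n # args) = Some 0 \<and> (\<forall>m<n. run p x (m # args) \<noteq> None)"
  have ex: "\<exists>n. ?stops n" and v: "v = (LEAST n. ?stops n)"
    using Mu.prems by (auto simp: Let_def split: if_splits)
  from ex have stops: "?stops v" unfolding v by (rule LeastI_ex)
  have "\<exists>u. run p x (m # args) = Some (Suc u)" if "m < v" for m
  proof -
    have "\<not> ?stops m" using not_less_Least that unfolding v by blast
    moreover have "\<forall>k<m. run p x (k # args) \<noteq> None" using stops that by auto
    ultimately have "run p x (m # args) \<noteq> Some 0" by blast
    moreover have "run p x (m # args) \<noteq> None" using stops that by blast
    ultimately show ?thesis by (metis not0_implies_Suc option.exhaust)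
  qed
  then obtain u where u: "\<And>m. m < v \<Longrightarrow> run p x (m # args) = Some (Suc (u m))" by metis
  let ?T = "insert (triple (code p) (list_encode (v # args)) 0)
    ((\<lambda>m. triple (code p) (list_encode (m # args)) (Suc (u m))) ` {..<v})"
  show ?case
  proof (rule derivable_step[of ?T _ 0])
    show "derivable x p' a' v'" if "triple p' a' v' \<in> ?T" for p' a' v'
      using that Mu.IH[OF u] Mu.IH stops by (auto simp del: list_encode.simps)
    show "justified x 0 ?T (code (Mu p)) (list_encode args) v"
      unfolding justified_def by (auto simp: lcons_encode simp del: list_encode.simps)
  qed auto
qed

text \<open>
  Both resources, the size of the (coded) certificate and the part of the oracle that may be
  questioned, are bounded by the stage \<open>s\<close>.  So acceptance at stage \<open>s\<close> is decidable, grows with \<open>s\<close>,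
  and depends on the first \<open>s\<close> bits of the oracle.
\<close>

definition accepts :: "cantor \<Rightarrow> nat \<Rightarrow> nat \<Rightarrow> nat \<Rightarrow> nat \<Rightarrow> bool" where
  "accepts x s p a v \<longleftrightarrow>
     (\<exists>c<s. certificate x s (set_decode c) \<and> triple p a v \<in> set_decode c)"

lemma accepts_mono: "accepts x s p a v \<Longrightarrow> s \<le> s' \<Longrightarrow> accepts x s' p a v"
  unfolding accepts_def by (meson certificate_mono less_le_trans)

lemma accepts_cong:
  assumes "\<And>b. b < s \<Longrightarrow> x b = y b"
  shows "accepts x s p a v = accepts y s p a v"
  unfolding accepts_def using certificate_cong[of s x y, OF assms] by blast

theorem run_iff_accepts:
  "run p x args = Some v \<longleftrightarrow> (\<exists>s. accepts x s (code p) (list_encode args) v)"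
proof
  assume "run p x args = Some v"
  then obtain s S where S: "finite S" "certificate x s S" "triple (code p) (list_encode args) v \<in> S"
    using derivable_run unfolding derivable_def by blast
  then have "accepts x (max s (Suc (set_encode S))) (code p) (list_encode args) v"
    unfolding accepts_def
    by (intro exI[of _ "set_encode S"]) (auto intro: certificate_mono)
  then show "\<exists>s. accepts x s (code p) (list_encode args) v" by blast
qed (auto simp: accepts_def intro: certificate_sound)

lemma member_set_decode_less:
  assumes "n \<in> set_decode c"
  shows "n < c"
proof -
  have "c div 2 ^ n \<noteq> 0" using assms by (metis even_zero mem_Collect_eq set_decode_def)
  then have "2 ^ n \<le> c" by (metis div_less not_le)
  then show ?thesis using less_exp[of n] by linarith
qed

lemma triple_le: "a \<le> triple p a v" "v \<le> triple p a v"
  using le_prod_encode_1[of a v] le_prod_encode_2[of v a] le_prod_encode_2[of "prod_encode (a, v)" p]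
  by (simp_all add: triple_def)

lemma triple_in_set_decode_less:
  assumes "triple p a v \<in> set_decode c"
  shows "p < c" "a < c" "v < c"
  using member_set_decode_less[OF assms] triple_le[of a p v] triple_le[of v p a]
    le_prod_encode_1[of p "prod_encode (a, v)"]
  by (simp_all add: triple_def)

text \<open>
  Members of a coded set are smaller than its code, and the components of a triple are at most the
  triple.  So every unbounded quantifier in the definition of a certificate can be bounded by the code of the
  certificate.
\<close>

lemma ex_triple_bounded:
  "(\<exists>w. P w \<and> triple p w v \<in> set_decode c \<and> Q w) \<longleftrightarrow>
   (\<exists>w<c. P w \<and> triple p w v \<in> set_decode c \<and> Q w)"
  "(\<exists>u. triple p a u \<in> set_decode c \<and> R u) \<longleftrightarrow>
   (\<exists>u<c. triple p a u \<in> set_decode c \<and> R u)"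
  "(\<exists>u. triple p a (Suc u) \<in> set_decode c) \<longleftrightarrow>
   (\<exists>u<c. triple p a (Suc u) \<in> set_decode c)"
  by (auto dest: triple_in_set_decode_less Suc_lessD)

lemma recursive_triple:
  "recursive k A \<Longrightarrow> recursive k B \<Longrightarrow> recursive k C \<Longrightarrow> recursive k (\<lambda>x e. triple (A x e) (B x e) (C x e))"
  unfolding triple_def by (intro recursive_intros)

lemma certificate_bounded:
  "certificate x s (set_decode c) \<longleftrightarrow>
    (\<forall>p<c. \<forall>a<c. \<forall>v<c. triple p a v \<in> set_decode c \<longrightarrow> justified x s (set_decode c) p a v)"
  unfolding certificate_def using triple_in_set_decode_less by blast

text \<open>
  A number is read as the oracle given by its binary digits, so that the numbers below \<open>2 ^ s\<close>
  run through all oracle prefixes of length \<open>s\<close>.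
\<close>

definition bits :: "nat \<Rightarrow> cantor" where
  "bits \<sigma> = (\<lambda>a. a \<in> set_decode \<sigma>)"

lemma recursive_bits:
  "recursive k A \<Longrightarrow> recursive k B \<Longrightarrow> recursive k (\<lambda>x e. of_bool (bits (A x e) (B x e)))"
  unfolding bits_def by (rule recursive_in_set_decode)

lemma recursive_accepts_bits:
  assumes "recursive k Z" "recursive k A" "recursive k B" "recursive k C" "recursive k D"
  shows "recursive k (\<lambda>x e. of_bool (accepts (bits (Z x e)) (A x e) (B x e) (C x e) (D x e)))"
proof -
  have 5: "length [Z, A, B, C, D] = 5" by simp
  have "recursive 5 (\<lambda>x e. of_bool (accepts (bits (e 0)) (e 1) (e 2) (e 3) (e 4)))"
    unfolding accepts_def certificate_bounded justified_def ex_triple_bounded bits_def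
    by (intro recursive_intros recursive_triple; simp)
  from recursive_compose[of "[Z, A, B, C, D]", unfolded 5, OF this] assms
  show ?thesis by (simp add: numeral_eq_Suc)
qed

section \<open>The uniform measure\<close>

definition coin :: "cantor measure" where
  "coin = (\<Pi>\<^sub>M i\<in>(UNIV :: nat set). measure_pmf (bernoulli_pmf (1/2)))"

lemma cantor_measure_eq: "\<mu> = completion coin"
  by (simp add: cantor_measure_def coin_def)

lemma space_coin [simp]: "space coin = UNIV"
  by (simp add: coin_def space_PiM)

lemma measurable_bit [measurable]: "(\<lambda>z. z i) \<in> coin \<rightarrow>\<^sub>M count_space UNIV"
proof -
  have "(\<lambda>z. z i) \<in> coin \<rightarrow>\<^sub>M measure_pmf (bernoulli_pmf (1/2))"
    unfolding coin_def by (rule measurable_component_singleton) simp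
  then show ?thesis
    by (simp cong: measurable_cong_sets)
qed

interpretation coin: prob_space coin
  unfolding coin_def by (rule prob_space_PiM) (rule prob_space_measure_pmf)

lemma measure_agree:
  assumes "finite J"
  shows "{z. \<forall>i\<in>J. z i = b i} \<in> sets coin"
    and "measure coin {z. \<forall>i\<in>J. z i = b i} = (1/2) ^ card J"
proof -
  show "{z. \<forall>i\<in>J. z i = b i} \<in> sets coin"
  proof -
    have "{z \<in> space coin. \<forall>i\<in>J. z i = b i} \<in> sets coin"
      using assms by measurable
    then show ?thesis by simp
  qed
  interpret product_prob_space "\<lambda>_. measure_pmf (bernoulli_pmf (1/2))" "UNIV :: nat set"
    by unfold_locales
  have one: "emeasure (measure_pmf (bernoulli_pmf (1/2))) {c} = ennreal (1/2)" for c
    by (cases c) (simp_all add: emeasure_pmf_single)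
  have "emeasure coin {z \<in> space coin. \<forall>i\<in>J. z i \<in> {b i}} = (\<Prod>i\<in>J. ennreal (1/2))"
    unfolding coin_def using emeasure_PiM_Collect[of J "\<lambda>i. {b i}"] assms
    by (simp add: one)
  then have "emeasure coin {z. \<forall>i\<in>J. z i = b i} = ennreal ((1/2) ^ card J)"
    by (simp only: prod_constant ennreal_power) simp
  then show "measure coin {z. \<forall>i\<in>J. z i = b i} = (1/2) ^ card J"
    by (simp add: measure_def)
qed

text \<open>
  The set \<open>D\<close> is decided by the first \<open>k\<close> bits; these are the clopen sets.
\<close>

definition determined :: "nat \<Rightarrow> cantor set \<Rightarrow> bool" where
  "determined k D \<longleftrightarrow> (\<forall>z z'. (\<forall>j<k. z j = z' j) \<longrightarrow> z \<in> D \<longrightarrow> z' \<in> D)"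

definition cyl :: "nat \<Rightarrow> nat \<Rightarrow> cantor set" where
  "cyl k \<sigma> = {z. \<forall>j<k. z j = bits \<sigma> j}"

lemma set_encode_lessThan: "set_encode {..<k} < 2 ^ k"
  by (induction k) (simp_all add: lessThan_Suc)

lemma ex_prefix_code: "\<exists>\<sigma><2 ^ k. z \<in> cyl k \<sigma>"
proof -
  let ?A = "{j. j < k \<and> z j}"
  have "set_encode ?A \<le> set_encode {..<k}"
    by (rule subset_decode_imp_le) auto
  then have "set_encode ?A < 2 ^ k" using set_encode_lessThan[of k] by linarith
  moreover have "z \<in> cyl k (set_encode ?A)" by (auto simp: cyl_def bits_def)
  ultimately show ?thesis by blast
qed

lemma prefix_code_unique:
  assumes "\<sigma> < 2 ^ k" "\<tau> < 2 ^ k" "z \<in> cyl k \<sigma>" "z \<in> cyl k \<tau>"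
  shows "\<sigma> = \<tau>"
proof -
  have less: "a < k" if "a \<in> set_decode \<rho>" "\<rho> < 2 ^ k" for a \<rho>
  proof (rule ccontr)
    assume "\<not> a < k"
    then have "(2::nat) ^ k \<le> 2 ^ a" by (intro power_increasing) auto
    then have "\<rho> div 2 ^ a = 0" using that(2) by (intro div_less) linarith
    then show False using that(1) by (simp add: set_decode_def)
  qed
  have "set_decode \<sigma> = set_decode \<tau>"
    using assms less unfolding cyl_def bits_def by blast
  then show ?thesis by (metis set_decode_inverse)
qed

lemma cyl_sets [measurable]: "cyl k \<sigma> \<in> sets coin"
  and measure_cyl: "measure coin (cyl k \<sigma>) = (1/2) ^ k"
  using measure_agree[of "{..<k}" "bits \<sigma>"] by (simp_all add: cyl_def Ball_def)

lemma UNIV_sets_coin: "UNIV \<in> sets coin"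
  using sets.top[of coin] by simp

lemma determined_eq_Un_cyl:
  assumes "determined k D"
  shows "D = (\<Union>\<sigma>\<in>{\<sigma>. \<sigma> < 2 ^ k \<and> bits \<sigma> \<in> D}. cyl k \<sigma>)"
proof (intro equalityI subsetI)
  fix z assume z: "z \<in> D"
  obtain \<sigma> where \<sigma>: "\<sigma> < 2 ^ k" "z \<in> cyl k \<sigma>" using ex_prefix_code by blast
  then have "bits \<sigma> \<in> D"
    using assms z unfolding determined_def cyl_def by blast
  with \<sigma> show "z \<in> (\<Union>\<sigma>\<in>{\<sigma>. \<sigma> < 2 ^ k \<and> bits \<sigma> \<in> D}. cyl k \<sigma>)" by blast
next
  fix z assume "z \<in> (\<Union>\<sigma>\<in>{\<sigma>. \<sigma> < 2 ^ k \<and> bits \<sigma> \<in> D}. cyl k \<sigma>)"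
  then obtain \<sigma> where "bits \<sigma> \<in> D" "\<forall>j<k. bits \<sigma> j = z j"
    unfolding cyl_def by auto
  then show "z \<in> D" using assms unfolding determined_def by blast
qed

lemma determined_sets:
  assumes "determined k D"
  shows "D \<in> sets coin"
  by (subst determined_eq_Un_cyl[OF assms]) (intro sets.finite_UN; simp add: cyl_sets)

lemma measure_Int_determined:
  assumes "determined k D" "A \<in> sets coin"
  shows "measure coin (A \<inter> D) = (\<Sum>\<sigma> | \<sigma> < 2 ^ k \<and> bits \<sigma> \<in> D. measure coin (A \<inter> cyl k \<sigma>))"
proof -
  let ?V = "{\<sigma>. \<sigma> < 2 ^ k \<and> bits \<sigma> \<in> D}"
  have "A \<inter> D = (\<Union>\<sigma>\<in>?V. A \<inter> cyl k \<sigma>)"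
    by (subst determined_eq_Un_cyl[OF assms(1)]) blast
  also have "measure coin \<dots> = (\<Sum>\<sigma>\<in>?V. measure coin (A \<inter> cyl k \<sigma>))"
    by (rule coin.finite_measure_finite_Union)
      (use assms(2) prefix_code_unique cyl_sets in \<open>auto simp: disjoint_family_on_def\<close>)
  finally show ?thesis .
qed

text \<open>
  This turns the measure of a clopen set into a finite count, which a program can carry out.
\<close>

lemma measure_determined:
  assumes "determined k D"
  shows "measure coin D = real (card {\<sigma>. \<sigma> < 2 ^ k \<and> bits \<sigma> \<in> D}) * (1/2) ^ k"
  using measure_Int_determined[OF assms UNIV_sets_coin]
  by (simp only: Int_UNIV_left measure_cyl sum_constant)

lemma determined_mono:
  assumes "determined k D" "k \<le> l"
  shows "determined l D"
  unfolding determined_def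
proof (intro allI impI)
  fix z z' assume "\<forall>j<l. z j = z' j" "z \<in> D"
  moreover from this(1) have "\<forall>j<k. z j = z' j" using assms(2) by auto
  ultimately show "z' \<in> D" using assms(1) unfolding determined_def by blast
qed

text \<open>
  Clopen sets are dense for the pseudometric of measure of the symmetric difference: the sets that
  can be approximated contain the generators and form a \<open>\<sigma>\<close>-algebra.
\<close>

lemma determined_approximation:
  assumes "D \<in> sets coin" "0 < \<epsilon>"
  shows "\<exists>k E. determined k E \<and> measure coin ((D - E) \<union> (E - D)) < \<epsilon>"
proof -
  have "D \<in> sigma_sets UNIV {{f. f i \<in> A} | i A. True}"
    using assms(1) by (simp add: coin_def sets_PiM_single)
  then have "\<forall>\<epsilon>>0. \<exists>k E. determined k E \<and> measure coin ((D - E) \<union> (E - D)) < \<epsilon>"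
  proof induction
    case (Basic a)
    then obtain i A where a: "a = {f. f i \<in> A}" by blast
    have "determined (Suc i) a" by (simp add: a determined_def)
    then show ?case by fastforce
  next
    case Empty
    show ?case by (auto simp: determined_def intro!: exI[of _ "{}"])
  next
    case (Compl a)
    show ?case
    proof (intro allI impI)
      fix \<epsilon> :: real assume "0 < \<epsilon>"
      with Compl.IH obtain k E where E: "determined k E" "measure coin ((a - E) \<union> (E - a)) < \<epsilon>"
        by blast
      have "determined k (- E)" using E(1) unfolding determined_def by (metis ComplD ComplI)
      moreover have "(UNIV - a - - E) \<union> (- E - (UNIV - a)) = (a - E) \<union> (E - a)" by blast
      ultimately show "\<exists>k E. determined k E \<and> measure coin (((UNIV - a) - E) \<union> (E - (UNIV - a))) < \<epsilon>"
        using E(2) by metis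
    qed
  next
    case (Union a)
    have sets: "a i \<in> sets coin" for i
      using Union.hyps[of i] by (simp add: coin_def sets_PiM_single)
    show ?case
    proof (intro allI impI)
      fix \<epsilon> :: real assume \<epsilon>: "0 < \<epsilon>"
      \<comment> \<open>Half of \<open>\<epsilon>\<close> pays for cutting off the union, the other half for the \<open>n\<close> remaining pieces.\<close>
      let ?U = "\<Union>i. a i" and ?B = "\<lambda>n. \<Union>i<n. a i"
      have "(\<lambda>n. measure coin (?B n)) \<longlonglongrightarrow> measure coin (\<Union>n. ?B n)"
        by (rule coin.finite_Lim_measure_incseq) (use sets in \<open>auto simp: incseq_def intro: less_le_trans\<close>)
      moreover have "(\<Union>n. ?B n) = ?U" by auto
      ultimately have "(\<lambda>n. measure coin (?B n)) \<longlonglongrightarrow> measure coin ?U" by simp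
      then have "\<forall>\<^sub>F n in sequentially. measure coin ?U - \<epsilon> / 2 < measure coin (?B n)"
        by (rule order_tendstoD) (use \<epsilon> in simp)
      then obtain n where n: "measure coin ?U - \<epsilon> / 2 < measure coin (?B n)"
        by (auto simp: eventually_sequentially)
      have "measure coin (?U - ?B n) = measure coin ?U - measure coin (?B n)"
        by (rule coin.finite_measure_Diff) (use sets in auto)
      with n have tail: "measure coin (?U - ?B n) < \<epsilon> / 2" by simp
      have "\<forall>i. \<exists>k E. determined k E \<and> measure coin ((a i - E) \<union> (E - a i)) < \<epsilon> / (2 * Suc n)"
        using Union.IH \<epsilon> by simp
      then obtain k E where E: "\<And>i. determined (k i) (E i)"
        "\<And>i. measure coin ((a i - E i) \<union> (E i - a i)) < \<epsilon> / (2 * Suc n)"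
        by metis
      let ?E = "\<Union>i<n. E i" and ?d = "\<lambda>i. (a i - E i) \<union> (E i - a i)"
      have d: "?d i \<in> sets coin" for i
        using sets determined_sets[OF E(1)] by auto
      have "determined (Max (insert 0 (k ` {..<n}))) (E i)" if "i < n" for i
        using determined_mono[OF E(1)[of i]] that by simp
      then have det: "determined (Max (insert 0 (k ` {..<n}))) ?E"
        unfolding determined_def by blast
      have "measure coin ((?U - ?E) \<union> (?E - ?U)) \<le> measure coin ((?U - ?B n) \<union> (\<Union>i<n. ?d i))"
        by (rule coin.finite_measure_mono) (use sets d in \<open>auto intro!: sets.Diff sets.Un sets.finite_UN\<close>)
      also have "\<dots> \<le> measure coin (?U - ?B n) + measure coin (\<Union>i<n. ?d i)"
        by (rule measure_Un_le) (use sets d in \<open>auto intro!: sets.Diff sets.finite_UN\<close>)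
      also have "measure coin (\<Union>i<n. ?d i) \<le> (\<Sum>i<n. measure coin (?d i))"
        by (rule measure_UNION_le) (use d in auto)
      also have "(\<Sum>i<n. measure coin (?d i)) \<le> (\<Sum>i<n. \<epsilon> / (2 * Suc n))"
        by (rule sum_mono) (use E(2) in \<open>auto intro: less_imp_le\<close>)
      also have "(\<Sum>i<n. \<epsilon> / (2 * Suc n)) \<le> \<epsilon> / 2"
        using \<epsilon> by (simp add: field_simps)
      finally have "measure coin ((?U - ?E) \<union> (?E - ?U)) < \<epsilon>"
        using tail by simp
      with det show "\<exists>k E. determined k E \<and> measure coin ((?U - E) \<union> (E - ?U)) < \<epsilon>" by blast
    qed
  qed
  then show ?thesis using assms(2) by blast
qed

text \<open>
  The fragment of the Lebesgue density theorem that is needed.  If \<open>A\<close> filled at most 3/4 of every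
  cylinder, then also of every clopen set, in particular of a clopen set that differs little from \<open>A\<close>;
  but \<open>A\<close> fills almost all of that one.
\<close>

lemma ex_dense_cylinder:
  assumes A: "A \<in> sets coin" and pos: "0 < measure coin A"
  shows "\<exists>k \<sigma>. 3 / 4 * (1/2) ^ k < measure coin (A \<inter> cyl k \<sigma>)"
proof (rule ccontr)
  assume "\<not> ?thesis"
  then have sparse: "measure coin (A \<inter> cyl k \<sigma>) \<le> 3 / 4 * measure coin (cyl k \<sigma>)" for k \<sigma>
    by (simp add: measure_cyl not_less)
  define \<epsilon> where "\<epsilon> = measure coin A / 8"
  have "0 < \<epsilon>" using pos by (simp add: \<epsilon>_def)
  then obtain k E where E: "determined k E" "measure coin ((A - E) \<union> (E - A)) < \<epsilon>"
    using determined_approximation[OF A] by blast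
  have [measurable]: "E \<in> sets coin" "A \<in> sets coin" using determined_sets[OF E(1)] A by auto
  have "measure coin (A \<inter> E) \<le> (\<Sum>\<sigma> | \<sigma> < 2 ^ k \<and> bits \<sigma> \<in> E. 3 / 4 * measure coin (cyl k \<sigma>))"
    unfolding measure_Int_determined[OF E(1) A] by (intro sum_mono sparse)
  also have "\<dots> = 3 / 4 * measure coin E"
    using measure_Int_determined[OF E(1) UNIV_sets_coin]
    by (simp only: Int_UNIV_left sum_distrib_left)
  finally have 1: "measure coin (A \<inter> E) \<le> 3 / 4 * measure coin E" .
  have "measure coin E \<le> measure coin (A \<union> ((A - E) \<union> (E - A)))"
    by (rule coin.finite_measure_mono) auto
  also have "\<dots> \<le> measure coin A + measure coin ((A - E) \<union> (E - A))"
    by (rule measure_Un_le) auto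
  finally have 2: "measure coin E \<le> measure coin A + \<epsilon>" using E(2) by simp
  have "measure coin A \<le> measure coin ((A \<inter> E) \<union> ((A - E) \<union> (E - A)))"
    by (rule coin.finite_measure_mono) auto
  also have "\<dots> \<le> measure coin (A \<inter> E) + measure coin ((A - E) \<union> (E - A))"
    by (rule measure_Un_le) auto
  finally have "measure coin A \<le> measure coin (A \<inter> E) + \<epsilon>" using E(2) by simp
  with 1 2 pos show False by (simp add: \<epsilon>_def)
qed

lemma null_imp_emeasure_cantor_0:
  assumes "S \<subseteq> N" "N \<in> null_sets coin"
  shows "emeasure \<mu> S = 0"
  using assms null_sets_completion_subset[of S N coin] null_sets_completionI[of N coin]
  by (auto simp: cantor_measure_eq)

section \<open>Martin-Loef tests for zeros at the even positions\<close>

text \<open>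
  An unbounded search whose test ignores the search variable halts at once or never.
\<close>

lemma comp_enumerable_recursive:
  assumes "recursive 1 (\<lambda>x e. of_bool (P (e 0)))"
  shows "comp_enumerable {n. P n}"
proof -
  have "recursive (Suc 1) (\<lambda>x e. of_bool (\<not> P (e (Suc 0))))"
    using recursive_not[OF recursive_weaken[OF assms]] by simp
  then obtain p where "\<forall>x args. length args = Suc 1 \<longrightarrow>
      run p x args = Some (of_bool (\<not> P (env args (Suc 0))))"
    unfolding recursive_def by blast
  then have p: "run p x [m, n] = Some (of_bool (\<not> P n))" for x m n
    by simp
  have "n \<in> {n. P n} \<longleftrightarrow> run (Mu p) (\<lambda>_. False) [n] \<noteq> None" for n
    by (simp add: p)
  then show ?thesis unfolding comp_enumerable_def by blast
qed

text \<open>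
  For each fixed \<open>N\<close> these sets form a Martin-Loef test.  It catches the inputs whose even half is
  zero (with \<open>N = 0\<close>) as well as the eventually zero sequences (with \<open>N\<close> past the last one), and in
  the verification of the one-wayness it shows that almost no \<open>y\<close> is eventually zero.
\<close>

definition zeros :: "nat \<Rightarrow> nat \<Rightarrow> cantor set" where
  "zeros N n = {x. \<forall>i<n. \<not> x (2 * (N + i))}"

lemma zeros_sets: "zeros N n \<in> sets coin"
  and measure_zeros: "measure coin (zeros N n) = (1/2) ^ n"
proof -
  have eq: "zeros N n = {z. \<forall>i\<in>(\<lambda>i. 2 * (N + i)) ` {..<n}. z i = False}"
    by (auto simp: zeros_def)
  have "card ((\<lambda>i. 2 * (N + i)) ` {..<n}) = n"
    by (subst card_image) (auto simp: inj_on_def)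
  then show "zeros N n \<in> sets coin" "measure coin (zeros N n) = (1/2) ^ n"
    unfolding eq using measure_agree[of "(\<lambda>i. 2 * (N + i)) ` {..<n}" "\<lambda>_. False"] by auto
qed

lemma zeros_martin_loef_test: "martin_loef_test (zeros N)"
proof -
  let ?P = "\<lambda>w. llen (psnd w) = 2 * (N + pfst w) \<and> (\<forall>i<pfst w. lnth (psnd w) (2 * (N + i)) = 0)"
  have "comp_enumerable {w. ?P w}"
    by (rule comp_enumerable_recursive) (intro recursive_intros; simp)
  moreover have "zeros N n = (\<Union>s \<in> {s. prod_encode (n, string_code s) \<in> {w. ?P w}}. cylinder s)" for n
  proof (intro equalityI subsetI)
    fix x assume x: "x \<in> zeros N n"
    let ?s = "map x [0..<2 * (N + n)]"
    have "prod_encode (n, string_code ?s) \<in> {w. ?P w}"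
      using x by (simp add: string_code_def zeros_def)
    moreover have "x \<in> cylinder ?s" by (simp add: cylinder_def)
    ultimately show "x \<in> (\<Union>s \<in> {s. prod_encode (n, string_code s) \<in> {w. ?P w}}. cylinder s)"
      by blast
  next
    fix x assume "x \<in> (\<Union>s \<in> {s. prod_encode (n, string_code s) \<in> {w. ?P w}}. cylinder s)"
    then obtain s where "prod_encode (n, string_code s) \<in> {w. ?P w}" "x \<in> cylinder s" by blast
    then show "x \<in> zeros N n"
      by (auto simp: string_code_def zeros_def cylinder_def)
  qed
  moreover have "emeasure \<mu> (zeros N n) \<le> ennreal ((1/2) ^ n)" for n
    by (simp add: cantor_measure_eq zeros_sets coin.emeasure_eq_measure measure_zeros)
  ultimately show ?thesis unfolding martin_loef_test_def by blast
qed

lemma MLR_not_eventually_zero: "x \<in> MLR \<Longrightarrow> \<exists>i. x (2 * (N + i))"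
  using zeros_martin_loef_test[of N] unfolding MLR_def zeros_def by fastforce

lemma zeros_null: "(\<Union>N. \<Inter>n. zeros N n) \<in> null_sets coin"
proof (intro null_sets_UN)
  fix N
  have sets: "(\<Inter>n. zeros N n) \<in> sets coin" using zeros_sets by blast
  have "measure coin (\<Inter>n. zeros N n) \<le> (1/2) ^ n" for n
    unfolding measure_zeros[of N n, symmetric]
    by (rule coin.finite_measure_mono) (use zeros_sets in auto)
  moreover have "(\<lambda>n. (1/2) ^ n :: real) \<longlonglongrightarrow> 0" by (rule LIMSEQ_realpow_zero) auto
  ultimately have "measure coin (\<Inter>n. zeros N n) \<le> 0" by (intro LIMSEQ_le_const) auto
  then show "(\<Inter>n. zeros N n) \<in> null_sets coin"
    using sets by (auto simp: null_sets_def coin.emeasure_eq_measure ennreal_eq_0_iff)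
qed

section \<open>The function\<close>

text \<open>
  An index \<open>n\<close> codes a triple \<open>(p, (t, k))\<close>: a program and the oracle prefix of length \<open>k\<close> given by
  the bits of \<open>t\<close>.  Position \<open>4 * n + 3\<close> of an input \<open>z \<oplus> (y \<oplus> h)\<close> holds \<open>h n\<close>.  So \<open>hits n i s\<close> is the
  set of oracles in the cylinder for which \<open>p\<close>, regarded as an inverter, is seen by stage \<open>s\<close> to propose
  the value \<open>i\<close> for \<open>h n\<close>.
\<close>

definition hits :: "nat \<Rightarrow> nat \<Rightarrow> nat \<Rightarrow> cantor set" where
  "hits n i s = {z \<in> cyl (psnd (psnd n)) (pfst (psnd n)).
     accepts z s (pfst n) (lcons (4 * n + 3) 0) i}"

definition votes :: "nat \<Rightarrow> nat \<Rightarrow> nat \<Rightarrow> nat" where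
  "votes n i s = (\<Sum>\<sigma><2 ^ s. of_bool (bits \<sigma> \<in> hits n i s))"

text \<open>
  More than a quarter of the cylinder votes for \<open>i\<close>, written without fractions.  The stage must reach
  the length of the prefix, for otherwise the votes do not measure \<open>hits n i s\<close>.
  The threshold goes with density 3/4: if two values share more than 3/4 of the cylinder, one of them
  exceeds 1/4; and a set that misses more than 1/4 of the cylinder cannot fill 3/4 of it.
\<close>

definition popular :: "nat \<Rightarrow> nat \<Rightarrow> nat \<Rightarrow> bool" where
  "popular n i s \<longleftrightarrow> psnd (psnd n) \<le> s \<and> 2 ^ s < 4 * 2 ^ psnd (psnd n) * votes n i s"

definition first :: "nat \<Rightarrow> nat \<Rightarrow> bool" where
  "first n s \<longleftrightarrow> (popular n 0 s \<or> popular n 1 s) \<and> (\<forall>r<s. \<not> popular n 0 r \<and> \<not> popular n 1 r)"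

text \<open>
  The value 0 wins a tie at the first stage with a popular value, so at most one of the two values
  is ever forbidden.
\<close>

definition forbidden :: "nat \<Rightarrow> bool \<Rightarrow> nat \<Rightarrow> bool" where
  "forbidden n b s \<longleftrightarrow> first n s \<and> (b \<longleftrightarrow> \<not> popular n 0 s)"

text \<open>
  The two ways to refute an input \<open>z \<oplus> (y \<oplus> h)\<close> by stage \<open>m\<close> both persist at later stages, so a refuted
  input is mapped to an eventually zero sequence.
\<close>

definition valid :: "cantor \<Rightarrow> nat \<Rightarrow> bool" where
  "valid x m \<longleftrightarrow> (\<forall>i<Suc m. \<not> x (2 * i)) \<and>
     (\<forall>n<Suc m. \<forall>s<Suc m. \<not> forbidden n (x (4 * n + 3)) s)"

definition oneway :: "cantor \<Rightarrow> cantor" where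
  "oneway x m \<longleftrightarrow> x (4 * m + 1) \<and> valid x m"

lemma recursive_popular:
  "recursive k A \<Longrightarrow> recursive k B \<Longrightarrow> recursive k C \<Longrightarrow>
   recursive k (\<lambda>x e. of_bool (popular (A x e) (B x e) (C x e)))"
proof (rule recursive_compose3[where F = "\<lambda>x a b c. of_bool (popular a b c)"])
  show "recursive 3 (\<lambda>x e. of_bool (popular (e 0) (e 1) (e 2)))"
    unfolding popular_def votes_def hits_def cyl_def mem_Collect_eq
    by (intro recursive_intros recursive_accepts_bits recursive_bits; simp)
qed

lemma total_computable_oneway: "total_computable oneway"
proof -
  have "recursive 1 (\<lambda>x e. of_bool (oneway x (e 0)))"
    unfolding oneway_def valid_def forbidden_def first_def
    by (intro recursive_intros recursive_popular; simp)
  then obtain p where "\<forall>x args. length args = 1 \<longrightarrow>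
      run p x args = Some (of_bool (oneway x (env args 0)))"
    unfolding recursive_def by blast
  then have "run p x [n] = Some (of_bool (oneway x n))" for x n
    by simp
  then show ?thesis
    unfolding total_computable_def partial_computable_def by (intro exI[of _ p]) simp
qed

lemma not_valid_mono: "\<not> valid x m \<Longrightarrow> m \<le> m' \<Longrightarrow> \<not> valid x m'"
  unfolding valid_def by (meson less_le_trans Suc_le_mono)

lemma oneway_eventually_zero: "\<not> valid x m \<Longrightarrow> \<not> oneway x (2 * (m + i))"
  using not_valid_mono[of x m "2 * (m + i)"] by (simp add: oneway_def)

text \<open>
  For each \<open>n\<close> there is at most one first stage with a popular value, and it rules out a single bit.
\<close>

lemma ex_avoids_forbidden: "\<exists>h. \<forall>n s. \<not> forbidden n (h n) s"
proof -
  have "\<exists>b. \<forall>s. \<not> forbidden n b s" for n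
  proof (cases "\<exists>s. first n s")
    case True
    then obtain s where s: "first n s" by blast
    then have "r = s" if "first n r" for r
      using that unfolding first_def by (meson linorder_neqE_nat)
    then show ?thesis unfolding forbidden_def by blast
  qed (auto simp: forbidden_def)
  then show ?thesis by metis
qed

lemma surj_oneway: "surj oneway"
  unfolding surj_def
proof
  fix y :: cantor
  obtain h where h: "\<And>n s. \<not> forbidden n (h n) s" using ex_avoids_forbidden by metis
  let ?x = "(\<lambda>_. False) \<oplus> (y \<oplus> h)"
  have "?x (2 * i) = False" "?x (4 * i + 1) = y i" "?x (4 * i + 3) = h i" for i
  proof -
    have "(4 * i + 1) div 2 = 2 * i" "(4 * i + 3) div 2 = 2 * i + 1" by presburger+
    then show "?x (2 * i) = False" "?x (4 * i + 1) = y i" "?x (4 * i + 3) = h i"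
      by (simp_all add: join_def)
  qed
  then have "oneway ?x = y"
    using h by (auto simp: oneway_def valid_def fun_eq_iff)
  then show "\<exists>x. y = oneway x" by metis
qed

lemma oneway_MLR: "oneway ` MLR \<inter> MLR = {}"
proof -
  have "oneway x \<notin> MLR" if mlr: "x \<in> MLR" for x
  proof -
    obtain i where "x (2 * i)" using MLR_not_eventually_zero[OF mlr, of 0] by auto
    then have "\<not> valid x i" by (auto simp: valid_def)
    then show ?thesis
      using MLR_not_eventually_zero[of "oneway x" i] oneway_eventually_zero by blast
  qed
  then show ?thesis by blast
qed

section \<open>No program avoids the forbidden values with positive probability\<close>

lemma determined_hits:
  assumes "psnd (psnd n) \<le> s"
  shows "determined s (hits n i s)"
  unfolding determined_def
proof (intro allI impI)
  fix z z' :: cantor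
  assume eq: "\<forall>j<s. z j = z' j" and z: "z \<in> hits n i s"
  from z have "accepts z' s (pfst n) (lcons (4 * n + 3) 0) i"
    using accepts_cong[of s z z'] eq by (simp add: hits_def)
  moreover from z have "z' \<in> cyl (psnd (psnd n)) (pfst (psnd n))"
    using eq assms by (auto simp: hits_def cyl_def)
  ultimately show "z' \<in> hits n i s" by (simp add: hits_def)
qed

lemma popular_iff_measure:
  assumes "psnd (psnd n) \<le> s"
  shows "popular n i s \<longleftrightarrow> 1 / 4 * (1/2) ^ psnd (psnd n) < measure coin (hits n i s)"
proof -
  let ?k = "psnd (psnd n)"
  have "votes n i s = card {\<sigma>. \<sigma> < 2 ^ s \<and> bits \<sigma> \<in> hits n i s}"
    by (simp add: votes_def Collect_conj_eq lessThan_def)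
  then have *: "measure coin (hits n i s) = real (votes n i s) * (1/2) ^ s"
    using measure_determined[OF determined_hits[OF assms]] by simp
  have "popular n i s \<longleftrightarrow> real (2 ^ s) < real (4 * 2 ^ ?k * votes n i s)"
    unfolding popular_def of_nat_less_iff using assms by simp
  also have "\<dots> \<longleftrightarrow> 1 / 4 * (1/2) ^ ?k < measure coin (hits n i s)"
    unfolding * by (simp add: field_simps power_divide)
  finally show ?thesis .
qed

lemma hits_run:
  assumes "n = prod_encode (code p, prod_encode (t, k))"
  shows "(\<Union>s. hits n i s) = {z \<in> cyl k t. run p z [4 * n + 3] = Some i}"
proof -
  have "lcons (4 * n + 3) 0 = list_encode [4 * n + 3]" by (simp add: lcons_def)
  then show ?thesis
    unfolding run_iff_accepts using assms by (auto simp: hits_def)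
qed

lemma hits_incseq: "incseq (hits n i)"
  by (auto simp: incseq_def hits_def intro: accepts_mono)

lemma run_sets: "{z. run p z args = Some v} \<in> sets coin"
proof -
  have "{z. run p z args = Some v} = (\<Union>s. {z. accepts z s (code p) (list_encode args) v})"
    by (auto simp: run_iff_accepts)
  also have "\<dots> \<in> sets coin"
  proof (intro sets.countable_UN subsetI, elim rangeE)
    fix D s assume D: "D = {z. accepts z s (code p) (list_encode args) v}"
    have "determined s D"
      unfolding D determined_def using accepts_cong by (metis mem_Collect_eq)
    then show "D \<in> sets coin" by (rule determined_sets)
  qed
  finally show ?thesis .
qed

text \<open>
  The success set of \<open>p\<close> as a probabilistic algorithm that is to find an \<open>h\<close> without forbidden values.
\<close>

definition avoiders :: "functional \<Rightarrow> cantor set" where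
  "avoiders p = {z. \<forall>n. \<exists>b. run p z [4 * n + 3] = Some (of_bool b) \<and> (\<forall>s. \<not> forbidden n b s)}"

lemma avoiders_sets: "avoiders p \<in> sets coin"
proof -
  have [measurable]: "Measurable.pred coin (\<lambda>z. run p z args = Some v)" for args v
    using run_sets[of p args v] by (simp add: pred_def)
  have "{z \<in> space coin. \<forall>n. \<exists>b. run p z [4 * n + 3] = Some (of_bool b) \<and> (\<forall>s. \<not> forbidden n b s)}
      \<in> sets coin"
    by measurable
  then show ?thesis by (simp add: avoiders_def)
qed

text \<open>
  The diagonalization.  Were the measure positive, the avoiders would fill more than 3/4 of some
  cylinder.  At the index \<open>n\<close> of \<open>p\<close> and this cylinder, one of the values 0 and 1 would be the output of
  \<open>p\<close> on more than 3/8 of the cylinder and hence become popular, so some value is forbidden.  The forbidden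
  value is popular as well: more than 1/4 of the cylinder outputs it, and no oracle of this part is an
  avoider.
\<close>

lemma avoiders_null: "avoiders p \<in> null_sets coin"
proof (rule ccontr)
  let ?A = "avoiders p"
  note [measurable] = avoiders_sets[of p]
  assume "?A \<notin> null_sets coin"
  then have "0 < measure coin ?A"
    using avoiders_sets[of p] by (auto simp: null_sets_def coin.emeasure_eq_measure less_le)
  then obtain k t where dense: "3 / 4 * (1/2) ^ k < measure coin (?A \<inter> cyl k t)"
    using ex_dense_cylinder[OF avoiders_sets] by blast
  define n where "n = prod_encode (code p, prod_encode (t, k))"
  define D where "D i = {z \<in> cyl k t. run p z [4 * n + 3] = Some i}" for i
  have k: "psnd (psnd n) = k" by (simp add: n_def)
  have D_sets [measurable]: "D i \<in> sets coin" for i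
    using run_sets[of p "[4 * n + 3]" i] cyl_sets[of k t] by (simp add: D_def Collect_conj_eq sets.Int)
  have D_Un: "(\<Union>s. hits n i s) = D i" for i
    unfolding D_def by (rule hits_run) (rule n_def)
  have hits_sets: "hits n i s \<in> sets coin" if "k \<le> s" for i s
    using determined_sets[OF determined_hits] that k by simp
  have "measure coin (?A \<inter> cyl k t) \<le> measure coin (D 0 \<union> D 1)"
  proof (rule coin.finite_measure_mono)
    show "?A \<inter> cyl k t \<subseteq> D 0 \<union> D 1"
    proof
      fix z assume z: "z \<in> ?A \<inter> cyl k t"
      then obtain b where "run p z [4 * n + 3] = Some (of_bool b)"
        unfolding avoiders_def by blast
      then show "z \<in> D 0 \<union> D 1" using z by (cases b) (auto simp: D_def)
    qed
  qed simp
  also have "\<dots> \<le> measure coin (D 0) + measure coin (D 1)"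
    by (rule measure_Un_le) simp_all
  finally have "1 / 4 * (1/2) ^ k < measure coin (D 0) \<or> 1 / 4 * (1/2) ^ k < measure coin (D 1)"
    using dense zero_less_power[of "1 / 2 :: real" k] by linarith
  then obtain i where i: "i = 0 \<or> i = 1" "1 / 4 * (1/2) ^ k < measure coin (D i)" by blast
  have "(\<lambda>s. measure coin (hits n i (s + k))) \<longlonglongrightarrow> measure coin (\<Union>s. hits n i (s + k))"
    by (rule coin.finite_Lim_measure_incseq)
      (use hits_sets hits_incseq[of n i] in \<open>auto simp: incseq_def\<close>)
  moreover have "(\<Union>s. hits n i (s + k)) = D i"
  proof -
    have "hits n i s \<subseteq> hits n i (s + k)" for s
      using hits_incseq[of n i] by (simp add: incseq_def)
    then show ?thesis unfolding D_Un[symmetric] by blast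
  qed
  ultimately have "(\<lambda>s. measure coin (hits n i (s + k))) \<longlonglongrightarrow> measure coin (D i)"
    by (simp only:)
  from order_tendstoD(1)[OF this i(2)] obtain s where "1 / 4 * (1/2) ^ k < measure coin (hits n i (s + k))"
    by (auto simp: eventually_sequentially)
  then have "popular n i (s + k)"
    using popular_iff_measure[of n "s + k" i] k by simp
  then have ex: "\<exists>s. popular n 0 s \<or> popular n 1 s" using i(1) by blast
  define r where "r = (LEAST s. popular n 0 s \<or> popular n 1 s)"
  have first: "first n r"
    using LeastI_ex[OF ex] not_less_Least[of _ "\<lambda>s. popular n 0 s \<or> popular n 1 s"]
    unfolding r_def first_def by blast
  define b where "b \<longleftrightarrow> \<not> popular n 0 r"
  have forb: "forbidden n b r" using first by (simp add: forbidden_def b_def)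
  have pop: "popular n (of_bool b) r" using first by (auto simp: b_def first_def)
  then have "k \<le> r" by (simp add: popular_def k)
  then have "1 / 4 * (1/2) ^ k < measure coin (hits n (of_bool b) r)"
    using pop popular_iff_measure[of n r] k by simp
  also have "\<dots> \<le> measure coin (D (of_bool b))"
    by (rule coin.finite_measure_mono) (use D_Un in auto)
  finally have big: "1 / 4 * (1/2) ^ k < measure coin (D (of_bool b))" .
  have "measure coin (?A \<inter> cyl k t) \<le> measure coin (cyl k t - D (of_bool b))"
  proof (rule coin.finite_measure_mono)
    show "?A \<inter> cyl k t \<subseteq> cyl k t - D (of_bool b)"
    proof
      fix z assume z: "z \<in> ?A \<inter> cyl k t"
      then obtain c where c: "run p z [4 * n + 3] = Some (of_bool c)" "\<forall>s. \<not> forbidden n c s"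
        unfolding avoiders_def by blast
      then have "c \<noteq> b" using forb by blast
      then show "z \<in> cyl k t - D (of_bool b)" using z c(1) by (auto simp: D_def)
    qed
  qed (use cyl_sets in simp)
  also have "\<dots> = measure coin (cyl k t) - measure coin (D (of_bool b))"
    by (rule coin.finite_measure_Diff) (use cyl_sets D_sets in simp, use cyl_sets D_sets in simp, auto simp: D_def)
  finally show False using big dense by (simp add: measure_cyl)
qed

section \<open>One-wayness\<close>

text \<open>
  A preimage of \<open>y\<close> either is valid at all stages, and then its part \<open>h\<close> has no forbidden value, or
  makes \<open>y\<close> eventually zero.  Both happen with probability 0.
\<close>

lemma right_oneway_oneway: "right_oneway (\<lambda>x. Some (oneway x))"
  unfolding right_oneway_def
proof (intro conjI allI impI)
  show "partial_computable (\<lambda>x. Some (oneway x))"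
    using total_computable_oneway by (simp add: total_computable_def)
  have "ran (\<lambda>x. Some (oneway x)) = UNIV"
    using surj_oneway by (auto simp: ran_def surj_def) metis
  then show "0 < emeasure \<mu> (ran (\<lambda>x. Some (oneway x)))"
    using UNIV_sets_coin coin.emeasure_space_1 by (simp add: cantor_measure_eq)
  fix g assume "partial_computable g"
  then obtain p where p: "\<And>z w n. g z = Some w \<Longrightarrow> run p z [n] = Some (of_bool (w n))"
    unfolding partial_computable_def by blast
  let ?S = "{y \<oplus> r | y r. \<exists>w. g (y \<oplus> r) = Some w \<and> Some (oneway w) = Some y}"
  have "?S \<subseteq> avoiders p \<union> (\<Union>N. \<Inter>n. zeros N n)"
  proof
    fix z assume "z \<in> ?S"
    then obtain y r w where z: "z = y \<oplus> r" and w: "g z = Some w" "oneway w = y" by auto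
    show "z \<in> avoiders p \<union> (\<Union>N. \<Inter>n. zeros N n)"
    proof (cases "\<forall>m. valid w m")
      case True
      have "\<not> forbidden n (w (4 * n + 3)) s" for n s
        using True[rule_format, of "max n s"] by (auto simp: valid_def)
      with p[OF w(1)] have "z \<in> avoiders p" unfolding avoiders_def by blast
      then show ?thesis by blast
    next
      case False
      then obtain m where "\<not> valid w m" by blast
      then have "\<not> y (m + i)" for i
        using not_valid_mono[of w m "m + i"] w(2) by (auto simp: oneway_def)
      then have "z \<in> (\<Inter>n. zeros m n)" by (auto simp: zeros_def z join_def)
      then show ?thesis by blast
    qed
  qed
  moreover have "avoiders p \<union> (\<Union>N. \<Inter>n. zeros N n) \<in> null_sets coin"
    using avoiders_null zeros_null by (rule null_sets.Un)
  ultimately show "emeasure \<mu> ?S = 0" by (rule null_imp_emeasure_cantor_0)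
qed

text \<open>
  Every input that starts with 1 is mapped to the zero sequence, which is its own preimage; the
  inverter that always answers with it succeeds with probability at least 1/2.
\<close>

lemma not_left_oneway: "\<not> left_oneway (\<lambda>x. Some (oneway x))"
proof
  let ?zero = "\<lambda>_ :: nat. False"
  let ?g = "\<lambda>_ :: cantor. Some ?zero"
  assume *: "left_oneway (\<lambda>x. Some (oneway x))"
  have "partial_computable ?g"
    unfolding partial_computable_def by (intro exI[of _ Zero]) auto
  with * have 0: "emeasure \<mu> {x \<oplus> r | x r. \<exists>y w. Some (oneway x) = Some y \<and> ?g (y \<oplus> r) = Some w \<and>
      Some (oneway w) = Some y} = 0" (is "emeasure \<mu> ?S = 0")
    unfolding left_oneway_def by blast
  define evens where "evens = (\<lambda>(z :: cantor) n. z (2 * n))"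
  have join: "evens z \<oplus> (\<lambda>n. z (2 * n + 1)) = z" for z
    by (auto simp: join_def evens_def fun_eq_iff)
  have evens_join: "evens (x \<oplus> r) = x" for x r
    by (auto simp: join_def evens_def fun_eq_iff)
  have zero: "oneway ?zero = ?zero" by (auto simp: oneway_def)
  have S: "?S = {z. \<forall>m. \<not> oneway (evens z) m}"
  proof (intro equalityI subsetI)
    fix z assume "z \<in> ?S"
    then show "z \<in> {z. \<forall>m. \<not> oneway (evens z) m}" by (auto simp: zero evens_join dest: sym)
  next
    fix z assume "z \<in> {z. \<forall>m. \<not> oneway (evens z) m}"
    then have "oneway (evens z) = ?zero" by auto
    then show "z \<in> ?S"
      using join[of z] zero by (intro CollectI exI[of _ "evens z"] exI[of _ "\<lambda>n. z (2 * n + 1)"]) simp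
  qed
  have "{z \<in> space coin. \<forall>m. \<not> oneway (evens z) m} \<in> sets coin"
    unfolding oneway_def valid_def forbidden_def evens_def by measurable
  then have sets: "?S \<in> sets coin" unfolding S by simp
  let ?T = "{z. \<forall>i\<in>{0}. z i = True}"
  have "?T \<subseteq> ?S" unfolding S by (auto simp: oneway_def valid_def evens_def)
  then have "measure coin ?T \<le> measure coin ?S"
    using sets by (intro coin.finite_measure_mono) auto
  then have "0 < emeasure coin ?S"
    using measure_agree(2)[of "{0}" "\<lambda>_. True"] by (simp add: coin.emeasure_eq_measure)
  with 0 sets show False by (simp add: cantor_measure_eq)
qed

theorem theorem3p8:
  "\<exists>f :: cantor \<Rightarrow> cantor. total_computable f \<and>
     (surj f \<and> f ` MLR \<inter> MLR = {}) \<and>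
     (right_oneway (\<lambda>x. Some (f x)) \<and> \<not> left_oneway (\<lambda>x. Some (f x)))"
  using total_computable_oneway surj_oneway oneway_MLR right_oneway_oneway not_left_oneway
  by blast

end
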